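(* Let $\hat C=\int_0^1e^{-1/(1-u^2)}\,du$, let $\mu\colon\mathbb{R}^4\to\mathbb{R}^4$ and $B\in\mathbb{R}^{4\times4}$ be given by $$\mu(x)=\begin{pmatrix}\mathbf{1}_{(1,\infty)}(x_4)\cdot\exp\!\big(-\frac{1}{x_4^2-1}\big)\cdot\cos\!\big((x_3-\hat C)\cdot\exp(x_2^3)\big)\\0\\\mathbf{1}_{(-1,1)}(x_4)\cdot\exp\!\big(-\frac{1}{1-x_4^2}\big)\\1\end{pmatrix},\qquad B=\begin{pmatrix}0&0&0&0\\0&1&0&0\\0&0&0&0\\0&0&0&0\end{pmatrix}$$ for all $x=(x_1,x_2,x_3,x_4)\in\mathbb{R}^4$, let $(\Omega,\mathcal{F},\mathbb{P})$ be a probability space supporting a four-dimensional standard Brownian motion $W\colon[0,\infty)\times\Omega\to\mathbb{R}^4$ with continuous sample paths, and let $X=(X_1,X_2,X_3,X_4)\colon[0,\infty)\times\Omega\to\mathbb{R}^4$ be a stochastic process with continuous sample paths satisfying $X(t)=\int_0^t\mu(X(s))\,ds+BW(t)$ for all $t\in[0,\infty)$. For $h\in(0,\infty)$ let $Y^h=(Y^h_1,Y^h_2,Y^h_3,Y^h_4)\colon[0,\infty)\times\Omega\to\mathbb{R}^4$ be the Euler--Maruyama approximation process defined recursively by $Y^h(0)=0$ and $$Y^h(t)=Y^h(\lfloor t\rfloor_h^-)+\mu\big(Y^h(\lfloor t\rfloor_h^-)\big)\cdot\big(t-\lfloor t\rfloor_h^-\big)+B\big(W(t)-W(\lfloor t\rfloor_h^-)\big),\qquad\lfloor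 t\rfloor_h^-:=nh\ \text{ for } t\in(nh,(n+1)h],\ n\in\{0,1,\ldots\}.$$ Then $$\mathbb{E}[X_1(t)]-\mathbb{E}[Y^h_1(t)]\ge\exp\!\big(-14\,|\ln(h)|^{2/3}\big)$$ for all $h\in(0,\frac{1}{22}]$ and all $t\in[2,\infty)$ and, therefore, $$\lim_{h\searrow0}\left(\frac{\mathbb{E}\big[\|X(t)-Y^h(t)\|\big]}{h^\alpha}\right)=\lim_{h\searrow0}\left(\frac{\big\|\mathbb{E}[X(t)]-\mathbb{E}[Y^h(t)]\big\|}{h^\alpha}\right)=\begin{cases}0,&\alpha=0,\\\infty,&\alpha>0,\end{cases}$$ for all $\alpha\in[0,\infty)$ and all $t\in[2,\infty)$. In particular, for every $t\in[2,\infty)$ and every $\alpha,C,h_0\in(0,\infty)$ there exists a real number $h\in(0,h_0)$ such that $\|\mathbb{E}[X(t)]-\mathbb{E}[Y^h(t)]\|>C\cdot h^\alpha$.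
   Context: $\|\cdot\|$ is the Euclidean norm. The products involving an indicator function are understood to be $0$ where the indicator vanishes. *)

theory Defs
  imports "HOL-Probability.Probability"
begin

text \<open>
  Standard Brownian motion on \<open>[0, \<infinity>)\<close>; values at negative times are irrelevant.  The increment over
  \<open>[s, t]\<close> has law N(0, (t - s) I), whose Lebesgue density is the product of the coordinate
  densities (the second argument of \<^const>\<open>normal_density\<close> is the standard deviation).
  Continuity of the sample paths is not part of this definition.
\<close>

definition std_brownian_motion :: "'a measure \<Rightarrow> (real \<Rightarrow> 'a \<Rightarrow> real ^ 'd) \<Rightarrow> bool" where
  "std_brownian_motion M W \<longleftrightarrow>
     prob_space M \<and>
     (\<forall>t\<ge>0. W t \<in> borel_measurable M) \<and>
     (AE \<omega> in M. W 0 \<omega> = 0) \<and>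
     (\<forall>(n::nat) \<tau>. 0 \<le> \<tau> 0 \<and> (\<forall>i<n. \<tau> i < \<tau> (Suc i)) \<longrightarrow>
        prob_space.indep_vars M (\<lambda>_. borel) (\<lambda>i \<omega>. W (\<tau> (Suc i)) \<omega> - W (\<tau> i) \<omega>) {..<n}) \<and>
     (\<forall>s t. 0 \<le> s \<and> s < t \<longrightarrow>
        distributed M lborel (\<lambda>\<omega>. W t \<omega> - W s \<omega>)
          (\<lambda>x. ennreal (\<Prod>i\<in>UNIV. normal_density 0 (sqrt (t - s)) (x $ i))))"

definition continuous_paths ::
  "'a measure \<Rightarrow> (real \<Rightarrow> 'a \<Rightarrow> 'b::topological_space) \<Rightarrow> bool" where
  "continuous_paths M Z \<longleftrightarrow> (\<forall>\<omega>\<in>space M. continuous_on {0..} (\<lambda>t. Z t \<omega>))"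

text \<open>
  The largest grid point strictly below \<open>t\<close>, so that grid points themselves are moved one step
  to the left; see \<open>left_grid_eq\<close>.
\<close>

definition left_grid :: "real \<Rightarrow> real \<Rightarrow> real" where
  "left_grid h t = (of_int \<lceil>t / h\<rceil> - 1) * h"

lemma left_grid_eq:
  fixes h t :: real and n :: nat
  assumes "h > 0" "t \<in> {real n * h <.. (real n + 1) * h}"
  shows "left_grid h t = real n * h"
proof -
  have "\<lceil>t / h\<rceil> = int n + 1"
    using assms by (intro ceiling_unique) (auto simp: field_simps)
  then show ?thesis
    by (simp add: left_grid_def)
qed

lemma left_grid_decreasing:
  assumes "\<not> h \<le> 0" "\<not> t \<le> 0"
  shows "nat \<lceil>left_grid h t / h\<rceil> < nat \<lceil>t / h\<rceil>"
proof -
  have "0 < \<lceil>t / h\<rceil>"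
    using assms by simp
  moreover have "left_grid h t / h = of_int (\<lceil>t / h\<rceil> - 1)"
    using assms by (simp add: left_grid_def)
  then have "\<lceil>left_grid h t / h\<rceil> = \<lceil>t / h\<rceil> - 1"
    by (metis ceiling_of_int)
  ultimately show ?thesis by simp
qed

text \<open>
  The Euler--Maruyama recursion for \<open>dX = f(X) dt + A dW\<close> started at the origin.
  Outside \<open>h > 0\<close>, \<open>t > 0\<close> the value is 0; at \<open>t = 0\<close> this is the initial condition.
\<close>

function euler_maruyama ::
  "(real ^ 'n \<Rightarrow> real ^ 'n) \<Rightarrow> real ^ 'd ^ 'n \<Rightarrow> (real \<Rightarrow> 'a \<Rightarrow> real ^ 'd) \<Rightarrow> real \<Rightarrow> real \<Rightarrow> 'a \<Rightarrow> real ^ 'n"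
where
  "euler_maruyama f A W h t \<omega> =
     (if h \<le> 0 \<or> t \<le> 0 then 0
      else euler_maruyama f A W h (left_grid h t) \<omega>
         + (t - left_grid h t) *\<^sub>R f (euler_maruyama f A W h (left_grid h t) \<omega>)
         + A *v (W t \<omega> - W (left_grid h t) \<omega>))"
  by pat_completeness auto
termination
  by (relation "Wellfounded.measure (\<lambda>(f, A, W, h, t, \<omega>). nat \<lceil>t / h\<rceil>)")
    (auto simp only: wf_measure in_measure case_prod_conv de_Morgan_disj intro!: left_grid_decreasing)

declare euler_maruyama.simps [simp del]

definition C_hat :: real where
  "C_hat = (LBINT u=0..1. exp (- (1 / (1 - u\<^sup>2))))"

text \<open>
  Where an indicator vanishes the product is 0 as intended, since division by zero is total.
\<close>

definition drift :: "real ^ 4 \<Rightarrow> real ^ 4" where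
  "drift x = vector
     [indicator {1<..} (x $ 4) * exp (- (1 / ((x $ 4)\<^sup>2 - 1)))
        * cos ((x $ 3 - C_hat) * exp ((x $ 2) ^ 3)),
      0,
      indicator {-1<..<1} (x $ 4) * exp (- (1 / (1 - (x $ 4)\<^sup>2))),
      1]"

definition diffusion :: "real ^ 4 ^ 4" where
  "diffusion = vector
     [vector [0, 0, 0, 0],
      vector [0, 1, 0, 0],
      vector [0, 0, 0, 0],
      vector [0, 0, 0, 0]]"

lemma vector_4_nth:
  fixes a b c d :: "'a::zero"
  shows "(vector [a, b, c, d] :: 'a ^ 4) $ 1 = a" "(vector [a, b, c, d] :: 'a ^ 4) $ 2 = b"
    "(vector [a, b, c, d] :: 'a ^ 4) $ 3 = c" "(vector [a, b, c, d] :: 'a ^ 4) $ 4 = d"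
  unfolding vector_def by auto

lemma diffusion_mult: "diffusion *v w = vector [0, w $ 2, 0, 0]"
  by (simp add: vec_eq_iff forall_4 matrix_vector_mult_def sum_4 diffusion_def vector_4_nth)

end

theory Submission
  imports Defs "HOL-Real_Asymp.Real_Asymp"
begin

text \<open>
  The fourth coordinate is time. Up to time 1 the third coordinate integrates a decreasing function,
  so at time 1 the exact solution has reached \<^const>\<open>C_hat\<close> while the Euler scheme, being a left Riemann
  sum, overshoots it by some \<open>\<delta>\<close> between \<open>h / 600\<close> and \<open>h\<close>. After time 1 the exact
  first coordinate therefore integrates an increasing function \<open>f\<close>, whereas the Euler scheme
  sums \<open>f s * cos (\<delta> * exp (B s ^ 3))\<close> with a Brownian motion \<open>B\<close>. Every step of the scheme
  loses a nonnegative amount in expectation, and on steps in \<open>[3/2, 2]\<close> it loses at least the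
  step size times the probability that \<open>\<delta> * exp (B s ^ 3)\<close> lies in \<open>[pi/2, 3 * pi/2]\<close>. That
  event only asks \<open>B s\<close> to be of size \<open>\<bar>ln h\<bar> powr (1/3)\<close>, so its Gaussian probability
  decays more slowly than every power of \<open>h\<close>. Strong convergence
  follows by dominated convergence from the boundedness of Brownian paths on compact intervals.
\<close>

subsection \<open>The switching functions and their integrals\<close>

definition switch_on :: "real \<Rightarrow> real" where
  "switch_on s = indicator {1<..} s * exp (- (1 / (s\<^sup>2 - 1)))"

definition switch_off :: "real \<Rightarrow> real" where
  "switch_off s = indicator {-1<..<1} s * exp (- (1 / (1 - s\<^sup>2)))"

lemma drift_nth:
  "drift x $ 1 = switch_on (x $ 4) * cos ((x $ 3 - C_hat) * exp ((x $ 2) ^ 3))"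
  "drift x $ 2 = 0" "drift x $ 3 = switch_off (x $ 4)" "drift x $ 4 = 1"
  by (simp_all add: drift_def vector_4_nth switch_on_def switch_off_def)

lemma switch_on_measurable [measurable]: "switch_on \<in> borel_measurable borel"
  unfolding switch_on_def[abs_def] by measurable

lemma switch_off_measurable [measurable]: "switch_off \<in> borel_measurable borel"
  unfolding switch_off_def[abs_def] by measurable

lemma switch_on_nonneg [simp]: "0 \<le> switch_on s"
  by (simp add: switch_on_def)

lemma switch_off_nonneg [simp]: "0 \<le> switch_off s"
  by (simp add: switch_off_def)

lemma switch_on_eq_0: "s \<le> 1 \<Longrightarrow> switch_on s = 0"
  by (simp add: switch_on_def)

lemma switch_off_eq_0: "s \<ge> 1 \<Longrightarrow> switch_off s = 0"
  by (simp add: switch_off_def)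

lemma switch_on_le_1 [simp]: "switch_on s \<le> 1"
  by (cases "s > 1") (auto simp: switch_on_def intro!: one_le_power)

lemma switch_off_le_1 [simp]: "switch_off s \<le> 1"
  by (cases "\<bar>s\<bar> < 1") (auto simp: switch_off_def abs_square_le_1 indicator_def)

lemma switch_on_mono:
  assumes "s \<le> t" shows "switch_on s \<le> switch_on t"
proof (cases "s > 1")
  case True
  then have "1 < s\<^sup>2" by simp
  moreover have "s\<^sup>2 \<le> t\<^sup>2" using True assms by (intro power_mono) auto
  ultimately have "1 / (t\<^sup>2 - 1) \<le> 1 / (s\<^sup>2 - 1)"
    by (intro divide_left_mono) auto
  then show ?thesis using True assms by (simp add: switch_on_def)
qed (simp add: switch_on_eq_0)

lemma switch_off_antimono:
  assumes "0 \<le> s" "s \<le> t" shows "switch_off t \<le> switch_off s"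
proof (cases "t < 1")
  case True
  then have "t\<^sup>2 < 1" using assms by (simp add: abs_square_less_1)
  moreover have "s\<^sup>2 \<le> t\<^sup>2" using True assms by (intro power_mono) auto
  ultimately have "1 / (1 - s\<^sup>2) \<le> 1 / (1 - t\<^sup>2)"
    by (intro divide_left_mono) auto
  then show ?thesis using True assms by (simp add: switch_off_def)
qed (simp add: switch_off_eq_0)

lemma switch_on_lower:
  assumes "3 / 2 \<le> s" shows "exp (-1) \<le> switch_on s"
proof -
  have "exp (-1::real) \<le> switch_on (3/2)" by (simp add: switch_on_def power2_eq_square)
  also have "\<dots> \<le> switch_on s" by (rule switch_on_mono) fact
  finally show ?thesis .
qed

lemma exp_of_nat_le: "exp (real n) \<le> 3 ^ n"
  using power_mono[OF exp_le, of n] exp_of_nat_mult[of n "1::real"] by simp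

text \<open>With \<open>a = 1 / (1 - s^2)\<close> and \<open>b = 1 / (1 - t^2)\<close> the drop is
  exp(-b) * (exp(b - a) - 1), which is at least exp(-b) * (b - a). On [1/4, 3/4] one has b \<le> 3,
  so exp(-b) is at least 1/27. Moreover b - a is at least t^2 - s^2, hence at least (t - s) / 2
  because s + t \<ge> 1/2.\<close>

lemma switch_off_drop:
  assumes "1 / 4 \<le> s" "s \<le> t" "t \<le> 3 / 4"
  shows "(t - s) / 54 \<le> switch_off s - switch_off t"
proof -
  define a b where "a = 1 / (1 - s\<^sup>2)" and "b = 1 / (1 - t\<^sup>2)"
  have s2: "s\<^sup>2 \<le> t\<^sup>2" using assms by (intro power_mono) auto
  have t2: "t\<^sup>2 \<le> (3/4)\<^sup>2" using assms by (intro power_mono) auto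
  have d: "(t - s) / 2 \<le> t\<^sup>2 - s\<^sup>2"
  proof -
    have "(t - s) * (1/2) \<le> (t - s) * (t + s)" using assms by (intro mult_left_mono) auto
    then show ?thesis by (simp add: power2_eq_square algebra_simps)
  qed
  have p: "0 < 1 - s\<^sup>2" "0 < 1 - t\<^sup>2" "1 - s\<^sup>2 \<le> 1" "1 - t\<^sup>2 \<le> 1"
    using s2 t2 by (auto simp: power2_eq_square)
  have "b - a = (t\<^sup>2 - s\<^sup>2) / ((1 - s\<^sup>2) * (1 - t\<^sup>2))"
    using p by (simp add: a_def b_def field_simps)
  also have "\<dots> \<ge> (t\<^sup>2 - s\<^sup>2) / 1"
    using p s2 by (intro divide_left_mono) (auto intro: mult_le_one)
  finally have ba: "(t - s) / 2 \<le> b - a" using d by simp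
  have "b \<le> 3" using t2 p by (simp add: b_def field_simps power2_eq_square)
  have "exp (3::real) \<le> 27" using exp_of_nat_le[of 3] by simp
  then have "1 / 27 \<le> exp (-3::real)" by (simp add: exp_minus field_simps)
  also have "\<dots> \<le> exp (- b)" using \<open>b \<le> 3\<close> by simp
  finally have "(1 / 27) * ((t - s) / 2) \<le> exp (- b) * (b - a)"
    using assms ba by (intro mult_mono) auto
  also have "\<dots> \<le> exp (- b) * (exp (b - a) - 1)"
  proof (rule mult_left_mono)
    show "b - a \<le> exp (b - a) - 1" using exp_ge_add_one_self[of "b - a"] by linarith
  qed simp
  also have "\<dots> = exp (- a) - exp (- b)" by (simp add: algebra_simps flip: exp_add)
  also have "\<dots> = switch_off s - switch_off t"
    using assms by (simp add: switch_off_def a_def b_def)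
  finally show ?thesis by simp
qed

section \<open>Interval integrals of bounded functions\<close>

lemma interval_integrable_bounded:
  fixes f :: "real \<Rightarrow> 'b::{banach, second_countable_topology}" and a b :: real
  assumes "a \<le> b" "set_borel_measurable borel {a<..<b} f" "\<And>s. a < s \<Longrightarrow> s < b \<Longrightarrow> norm (f s) \<le> B"
  shows "interval_lebesgue_integrable lborel a b f"
proof -
  have "integrable lborel (\<lambda>s. indicator {a<..<b} s *\<^sub>R f s)"
  proof (rule Bochner_Integration.integrable_bound)
    show "integrable lborel (\<lambda>s. indicator {a<..<b} s *\<^sub>R B)"
      by (intro integrable_real_indicator integrable_scaleR_left) (auto simp: emeasure_lborel_Ioo \<open>a \<le> b\<close>)
    show "(\<lambda>s. indicator {a<..<b} s *\<^sub>R f s) \<in> borel_measurable lborel"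
      using assms(2) by (simp add: set_borel_measurable_def)
    show "AE s in lborel. norm (indicator {a<..<b} s *\<^sub>R f s) \<le> norm (indicator {a<..<b} s *\<^sub>R B)"
      using assms(3) by (force simp: indicator_def)
  qed
  then show ?thesis using \<open>a \<le> b\<close>
    by (simp add: interval_lebesgue_integrable_def set_integrable_def)
qed

lemma interval_integral_mono:
  fixes f g :: "real \<Rightarrow> real" and a b :: real
  assumes "a \<le> b" "interval_lebesgue_integrable lborel a b f"
    "interval_lebesgue_integrable lborel a b g" "\<And>s. a < s \<Longrightarrow> s < b \<Longrightarrow> f s \<le> g s"
  shows "(LBINT s=a..b. f s) \<le> (LBINT s=a..b. g s)"
  using assms by (auto simp: interval_lebesgue_integral_def interval_lebesgue_integrable_def
      intro!: set_integral_mono)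

lemma interval_integral_bounds:
  fixes f :: "real \<Rightarrow> real" and a b l u :: real
  assumes "a \<le> b" "f \<in> borel_measurable borel" "\<And>s. \<bar>f s\<bar> \<le> 1"
    and "\<And>s. a < s \<Longrightarrow> s < b \<Longrightarrow> l \<le> f s" "\<And>s. a < s \<Longrightarrow> s < b \<Longrightarrow> f s \<le> u"
  shows "(b - a) * l \<le> (LBINT s=0..b. f s) - (LBINT s=0..a. f s)"
    and "(LBINT s=0..b. f s) - (LBINT s=0..a. f s) \<le> (b - a) * u"
proof -
  have i: "interval_lebesgue_integrable lborel (ereal x) (ereal y) f" if "x \<le> y" for x y
    using that assms(2,3) by (intro interval_integrable_bounded[where B=1]) (auto simp: set_borel_measurable_def)
  have i': "interval_lebesgue_integrable lborel (ereal x) (ereal y) f" for x y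
    using i[of x y] i[of y x] interval_integrable_endpoints_reverse[of "ereal x" "ereal y" f] by (cases "x \<le> y") auto
  \<comment> \<open>\<open>interval_integral_sum\<close> wants integrability from the smallest to
    the largest of the three endpoints 0, \<open>a\<close>, \<open>b\<close>, computed in
    \<open>ereal\<close>. Rewriting these as real numbers makes \<open>i'\<close> applicable
    whatever the sign of \<open>a\<close> and \<open>b\<close>.\<close>
  have "min 0 (min (ereal a) (ereal b)) = ereal (min 0 (min a b))"
    "max 0 (max (ereal a) (ereal b)) = ereal (max 0 (max a b))"
    by (auto simp: min_def max_def zero_ereal_def)
  then have "(LBINT s=0..a. f s) + (LBINT s=a..b. f s) = (LBINT s=0..b. f s)"
    by (intro interval_integral_sum) (simp only: i')
  then have eq: "(LBINT s=0..b. f s) - (LBINT s=0..a. f s) = (LBINT s=a..b. f s)" by simp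
  have "(LBINT s=a..b. l) \<le> (LBINT s=a..b. f s)"
    using assms by (intro interval_integral_mono i) auto
  then show "(b - a) * l \<le> (LBINT s=0..b. f s) - (LBINT s=0..a. f s)"
    by (simp add: eq mult.commute)
  have "(LBINT s=a..b. f s) \<le> (LBINT s=a..b. u)"
    using assms by (intro interval_integral_mono i) auto
  then show "(LBINT s=0..b. f s) - (LBINT s=0..a. f s) \<le> (b - a) * u"
    by (simp add: eq mult.commute)
qed

text \<open>By \<open>sde_solution\<close> below, \<open>int_on\<close> and \<open>int_off\<close>
  are the first and third coordinates of the exact solution.\<close>

definition int_on :: "real \<Rightarrow> real" where
  "int_on t = (LBINT s=0..t. switch_on s)"

definition int_off :: "real \<Rightarrow> real" where
  "int_off t = (LBINT s=0..t. switch_off s)"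

lemma int_0 [simp]: "int_on 0 = 0" "int_off 0 = 0"
  by (simp_all add: int_on_def int_off_def flip: zero_ereal_def)

lemma int_on_bounds:
  assumes "s \<le> t"
  shows "(t - s) * switch_on s \<le> int_on t - int_on s"
    and "int_on t - int_on s \<le> (t - s) * switch_on t"
  unfolding int_on_def using assms
  by (auto intro!: interval_integral_bounds[where l="switch_on s" and u="switch_on t"] switch_on_mono)

lemma int_off_bounds:
  assumes "0 \<le> s" "s \<le> t"
  shows "(t - s) * switch_off t \<le> int_off t - int_off s"
    and "int_off t - int_off s \<le> (t - s) * switch_off s"
  unfolding int_off_def using assms
  by (auto intro!: interval_integral_bounds[where l="switch_off t" and u="switch_off s"] switch_off_antimono)

text \<open>\<open>switch_off\<close> vanishes from time 1 on. Along the exact solution the argument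
  of the cosine is therefore 0 wherever \<open>switch_on\<close> is nonzero.\<close>

lemma int_off_eq_C_hat:
  assumes "t \<ge> 1" shows "int_off t = C_hat"
proof -
  have "int_off t = int_off 1"
    using int_off_bounds[of 1 t] assms by (simp add: switch_off_eq_0)
  also have "\<dots> = C_hat"
    unfolding int_off_def C_hat_def one_ereal_def
    by (rule interval_integral_cong) (auto simp: einterval_iff switch_off_def zero_ereal_def)
  finally show ?thesis .
qed

text \<open>Splitting the step at its midpoint gives a finer left sum that still overestimates the
  integral. The coarse step exceeds the finer sum by h/2 times the drop of \<open>switch_off\<close>
  over half a step, and h/2 * (h/2) / 54 = h^2 / 216.\<close>

lemma int_off_step_error:
  assumes "1 / 4 \<le> s" "s + h \<le> 3 / 4" "0 \<le> h"
  shows "h\<^sup>2 / 216 \<le> h * switch_off s - (int_off (s + h) - int_off s)"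
proof -
  have "int_off (s + h/2) - int_off s \<le> (h/2) * switch_off s"
    "int_off (s + h) - int_off (s + h/2) \<le> (h/2) * switch_off (s + h/2)"
    using int_off_bounds(2)[of s "s + h/2"] int_off_bounds(2)[of "s + h/2" "s + h"] assms by simp_all
  moreover have "(h/2) * ((h/2) / 54) \<le> (h/2) * (switch_off s - switch_off (s + h/2))"
    using switch_off_drop[of s "s + h/2"] assms by (intro mult_left_mono) auto
  ultimately show ?thesis by (simp add: algebra_simps power2_eq_square)
qed

subsection \<open>Gaussian windows\<close>

text \<open>The product formula over \<open>Basis\<close>, reindexed by coordinates: the basis
  vectors are the \<open>axis i 1\<close>, and \<open>axis_index\<close> recovers
  \<open>i\<close>.\<close>

lemma nn_integral_lborel_prod_cart:
  fixes q :: "'d::finite \<Rightarrow> real \<Rightarrow> ennreal"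
  assumes [measurable]: "\<And>i. q i \<in> borel_measurable borel"
  shows "(\<integral>\<^sup>+x. (\<Prod>i\<in>UNIV. q i (x $ i)) \<partial>lborel) = (\<Prod>i\<in>UNIV. \<integral>\<^sup>+y. q i y \<partial>lborel)"
proof -
  have Basis: "(Basis :: (real ^ 'd) set) = range (\<lambda>i. axis i 1)"
    by (auto simp: Basis_vec_def)
  have inj: "inj (\<lambda>i::'d. axis i (1::real))"
    by (auto simp: inj_on_def axis_eq_axis)
  have *: "(\<Prod>b\<in>Basis. F b) = (\<Prod>i\<in>UNIV. F (axis i 1))" for F :: "real ^ 'd \<Rightarrow> ennreal"
    by (simp add: Basis prod.reindex[OF inj])
  show ?thesis
    using nn_integral_lborel_prod[of "\<lambda>b::real ^ 'd. q (axis_index b)"]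
    by (simp add: * axis_index_axis inner_axis)
qed

lemma borel_measurable_vec_nth [measurable (raw)]:
  fixes f :: "'a \<Rightarrow> real ^ 'd"
  shows "f \<in> borel_measurable M \<Longrightarrow> (\<lambda>x. f x $ i) \<in> borel_measurable M"
  by (rule measurable_compose) (auto intro!: borel_measurable_continuous_onI continuous_intros)

lemma borel_measurable_vecI:
  fixes f :: "'a \<Rightarrow> real ^ 'd"
  assumes "\<And>i. (\<lambda>x. f x $ i) \<in> borel_measurable M"
  shows "f \<in> borel_measurable M"
  using assms by (subst borel_measurable_euclidean_space) (auto simp: Basis_vec_def inner_axis)

text \<open>Marginals of a product density: an event about coordinate \<open>k\<close> only changes
  the \<open>k\<close>-th factor, and every other factor integrates to 1.\<close>

lemma distributed_vec_nth:
  fixes Z :: "'a \<Rightarrow> real ^ 'd" and q :: "'d \<Rightarrow> real \<Rightarrow> ennreal"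
  assumes Z: "distributed M lborel Z (\<lambda>x. \<Prod>i\<in>UNIV. q i (x $ i))"
    and [measurable]: "\<And>i. q i \<in> borel_measurable borel"
    and q: "\<And>i. (\<integral>\<^sup>+y. q i y \<partial>lborel) = 1"
  shows "distributed M lborel (\<lambda>\<omega>. Z \<omega> $ k) (q k)"
  unfolding distributed_def
proof (intro conjI)
  have [measurable]: "Z \<in> borel_measurable M"
    using distributed_measurable[OF Z] by simp
  show "(\<lambda>\<omega>. Z \<omega> $ k) \<in> M \<rightarrow>\<^sub>M lborel" "q k \<in> borel_measurable lborel" by simp_all
  show "distr M lborel (\<lambda>\<omega>. Z \<omega> $ k) = density lborel (q k)"
  proof (rule measure_eqI)
    fix A :: "real set" assume "A \<in> sets (distr M lborel (\<lambda>\<omega>. Z \<omega> $ k))"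
    then have [measurable]: "A \<in> sets borel" by simp
    \<comment> \<open>Absorbing the indicator into the \<open>k\<close>-th factor keeps the
      integrand a product of functions of single coordinates.\<close>
    define r where "r i y = q i y * (if i = k then indicator A y else 1)" for i y
    have [measurable]: "r i \<in> borel_measurable borel" for i
      unfolding r_def by measurable
    have "emeasure (distr M lborel (\<lambda>\<omega>. Z \<omega> $ k)) A = emeasure M (Z -` {x. x $ k \<in> A} \<inter> space M)"
      by (subst emeasure_distr) (auto intro!: arg_cong[where f="emeasure M"])
    also have "\<dots> = (\<integral>\<^sup>+x. (\<Prod>i\<in>UNIV. q i (x $ i)) * indicator {x. x $ k \<in> A} x \<partial>lborel)"
      by (rule distributed_emeasure[OF Z]) simp
    also have "\<dots> = (\<integral>\<^sup>+x. (\<Prod>i\<in>UNIV. r i (x $ i)) \<partial>lborel)"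
      by (intro nn_integral_cong) (simp add: r_def prod.distrib indicator_def prod.delta)
    also have "\<dots> = (\<Prod>i\<in>UNIV. \<integral>\<^sup>+y. r i y \<partial>lborel)"
      by (rule nn_integral_lborel_prod_cart) simp
    also have "\<dots> = (\<Prod>i\<in>UNIV. if i = k then \<integral>\<^sup>+y. q k y * indicator A y \<partial>lborel else 1)"
      by (intro prod.cong) (auto simp: r_def q)
    also have "\<dots> = emeasure (density lborel (q k)) A"
      by (simp add: prod.delta emeasure_density)
    finally show "emeasure (distr M lborel (\<lambda>\<omega>. Z \<omega> $ k)) A = emeasure (density lborel (q k)) A" .
  qed simp
qed

lemma std_brownian_motion_nth:
  assumes "std_brownian_motion M W" "0 \<le> s" "s < t"
  shows "distributed M lborel (\<lambda>\<omega>. W t \<omega> $ k - W s \<omega> $ k) (normal_density 0 (sqrt (t - s)))"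
proof -
  have "distributed M lborel (\<lambda>\<omega>. W t \<omega> - W s \<omega>)
      (\<lambda>x. \<Prod>i\<in>UNIV. ennreal (normal_density 0 (sqrt (t - s)) (x $ i)))"
    using assms by (simp add: std_brownian_motion_def prod_ennreal)
  moreover have "(\<integral>\<^sup>+y. ennreal (normal_density 0 (sqrt (t - s)) y) \<partial>lborel) = 1"
    using assms by (subst nn_integral_eq_integral) auto
  ultimately show ?thesis
    using distributed_vec_nth[of M "\<lambda>\<omega>. W t \<omega> - W s \<omega>" "\<lambda>_ y. ennreal (normal_density 0 (sqrt (t - s)) y)" k]
    by simp
qed

section \<open>Normal variables: moments and probabilities of intervals\<close>

lemma (in prob_space) integrable_normal_distributed:
  assumes "distributed M lborel Z (normal_density 0 \<sigma>)" "0 < \<sigma>"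
  shows "integrable M Z"
proof -
  have "integrable lborel (\<lambda>x. normal_density 0 \<sigma> x * x)"
    using integrable_normal_moment_nz_1[OF assms(2)] .
  then show ?thesis
    using distributed_integrable[OF assms(1), of "\<lambda>x. x"] by simp
qed

text \<open>The centred normal density decreases on the nonnegative axis, so over
  \<open>{a..b}\<close> it is smallest at \<open>b\<close>.\<close>

lemma (in prob_space) normal_interval_ge:
  assumes Z: "distributed M lborel Z (normal_density 0 \<sigma>)" and "0 < \<sigma>" "0 \<le> a" "a \<le> b"
  shows "(b - a) * normal_density 0 \<sigma> b \<le> prob (Z -` {a..b} \<inter> space M)"
proof -
  have "ennreal ((b - a) * normal_density 0 \<sigma> b) = (\<integral>\<^sup>+x. ennreal (normal_density 0 \<sigma> b) * indicator {a..b} x \<partial>lborel)"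
    using \<open>a \<le> b\<close> by (simp add: nn_integral_cmult ennreal_mult mult.commute)
  also have "\<dots> \<le> (\<integral>\<^sup>+x. ennreal (normal_density 0 \<sigma> x) * indicator {a..b} x \<partial>lborel)"
  proof (intro nn_integral_mono)
    fix x
    have "normal_density 0 \<sigma> b \<le> normal_density 0 \<sigma> x" if "x \<in> {a..b}"
    proof -
      have "x\<^sup>2 \<le> b\<^sup>2" using that \<open>0 \<le> a\<close> by (intro power_mono) auto
      then show ?thesis using \<open>0 < \<sigma>\<close> by (auto simp: normal_density_def divide_simps)
    qed
    then show "ennreal (normal_density 0 \<sigma> b) * indicator {a..b} x \<le> ennreal (normal_density 0 \<sigma> x) * indicator {a..b} x"
      by (auto simp: indicator_def intro!: ennreal_leI)
  qed
  also have "\<dots> = emeasure M (Z -` {a..b} \<inter> space M)"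
    by (rule distributed_emeasure[OF Z, symmetric]) simp
  finally show ?thesis by (simp add: emeasure_eq_measure)
qed

lemma cos_le_0: "pi / 2 \<le> x \<Longrightarrow> x \<le> 3 * pi / 2 \<Longrightarrow> cos x \<le> 0"
  using sin_ge_zero[of "x - pi / 2"] by (simp add: sin_diff)

text \<open>Let a^3 = ln (pi / (2 * \<delta>)). On the window a \<le> Z \<le> b the argument of the
  cosine lies in [pi/2, 3 * pi/2], so 1 - cos is at least 1; elsewhere it is at least 0. The
  expected loss thus dominates the probability of the window, which is at least its length times the
  density at \<open>b\<close>. Both factors are bounded below by exponentials in b^2, with exponents
  adding up to 1 + 1/3 and constants 3 and 4.\<close>

lemma (in prob_space) expectation_cos_le:
  assumes Z: "distributed M lborel Z (normal_density 0 (sqrt s))" and s: "3 / 2 \<le> s" "s \<le> 2"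
    and \<delta>: "0 < \<delta>" "\<delta> \<le> 1" and b: "b ^ 3 = ln (3 * pi / (2 * \<delta>))"
  shows "expectation (\<lambda>\<omega>. cos (\<delta> * exp (Z \<omega> ^ 3))) \<le> 1 - exp (- (4 / 3 * b\<^sup>2)) / 12"
proof -
  have [measurable]: "Z \<in> borel_measurable M" using distributed_measurable[OF Z] by simp
  define a where "a = root 3 (ln (pi / (2 * \<delta>)))"
  have a3: "a ^ 3 = ln (pi / (2 * \<delta>))" by (simp add: a_def odd_real_root_pow)
  have "pi / (2 * \<delta>) \<ge> 1" using \<delta> pi_ge_two by (simp add: field_simps)
  then have "0 \<le> a" by (simp add: a_def)
  have "3 * pi / (2 * \<delta>) = 3 * (pi / (2 * \<delta>))" by simp
  then have "b ^ 3 = ln 3 + a ^ 3"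
    unfolding a3 b using \<delta> by (subst ln_mult_pos[symmetric]) auto
  moreover have "ln 3 \<ge> (1::real)" using exp_le by (subst ln_ge_iff) auto
  ultimately have ab: "b ^ 3 - a ^ 3 \<ge> 1" by simp
  then have "a ^ 3 < b ^ 3" by simp
  then have "a < b" using power_mono_odd[of 3 b a] by (meson linorder_not_less odd_numeral)
  \<comment> \<open>Factoring b^3 - a^3 turns the gap ln 3 \<ge> 1 between the cubes into a lower
    bound for the length b - a. The final estimate of b^2 by exp (b^2) gives it the same exponential
    shape as the density.\<close>
  have "1 \<le> (b - a) * (a\<^sup>2 + a * b + b\<^sup>2)"
    using ab by (simp add: algebra_simps power2_eq_square power3_eq_cube)
  also have "\<dots> \<le> (b - a) * (3 * b\<^sup>2)"
  proof (rule mult_left_mono)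
    have "a\<^sup>2 \<le> b\<^sup>2" "a * b \<le> b * b"
      using \<open>0 \<le> a\<close> \<open>a < b\<close> by (auto intro!: power_mono mult_right_mono)
    then show "a\<^sup>2 + a * b + b\<^sup>2 \<le> 3 * b\<^sup>2" by (simp add: power2_eq_square)
  qed (use \<open>a < b\<close> in simp)
  also have "\<dots> \<le> (b - a) * (3 * exp (b\<^sup>2))"
    using exp_ge_add_one_self[of "b\<^sup>2"] \<open>a < b\<close> by (intro mult_left_mono) linarith+
  finally have ba: "exp (- b\<^sup>2) / 3 \<le> b - a" by (simp add: exp_minus field_simps)
  \<comment> \<open>The upper bound on the variance \<open>s\<close> controls the normalising
    factor, as 2 * pi * s \<le> 16, and the lower bound controls the exponent, as 2 * s \<ge>
    3.\<close>
  have dens: "exp (- (b\<^sup>2 / 3)) / 4 \<le> normal_density 0 (sqrt s) b"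
  proof -
    have "2 * pi * s \<le> 2 * 4 * 2"
      using s pi_less_4 by (intro mult_mono) auto
    then have "sqrt (2 * pi * s) \<le> sqrt (4\<^sup>2)" by (intro real_sqrt_le_mono) simp
    then have "sqrt (2 * pi * s) \<le> 4" by simp
    then have "1 / 4 \<le> 1 / sqrt (2 * pi * s)" using s by (intro divide_left_mono) auto
    moreover have "b\<^sup>2 / (2 * s) \<le> b\<^sup>2 / 3" using s by (intro divide_left_mono) auto
    then have "exp (- (b\<^sup>2 / 3)) \<le> exp (- b\<^sup>2 / (2 * s))" by simp
    ultimately have "1 / 4 * exp (- (b\<^sup>2 / 3)) \<le> 1 / sqrt (2 * pi * s) * exp (- b\<^sup>2 / (2 * s))"
      using s by (intro mult_mono) auto
    then show ?thesis using s by (simp add: normal_density_def)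
  qed
  have "exp (- (4 / 3 * b\<^sup>2)) / 12 = exp (- b\<^sup>2) / 3 * (exp (- (b\<^sup>2 / 3)) / 4)"
    by (simp flip: exp_add)
  also have "\<dots> \<le> (b - a) * normal_density 0 (sqrt s) b"
    using ba dens \<open>a < b\<close> by (intro mult_mono) auto
  also have "\<dots> \<le> prob (Z -` {a..b} \<inter> space M)"
    using s \<open>0 \<le> a\<close> \<open>a < b\<close> by (intro normal_interval_ge[OF Z]) auto
  also have "\<dots> = expectation (\<lambda>\<omega>. indicator (Z -` {a..b} \<inter> space M) \<omega>)"
    by (simp add: measurable_sets)
  also have "\<dots> \<le> expectation (\<lambda>\<omega>. 1 - cos (\<delta> * exp (Z \<omega> ^ 3)))"
  proof (rule integral_mono)
    show "integrable M (\<lambda>\<omega>. indicator (Z -` {a..b} \<inter> space M) \<omega> :: real)"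
      by (intro integrable_real_indicator) (auto simp: emeasure_eq_measure)
    show "integrable M (\<lambda>\<omega>. 1 - cos (\<delta> * exp (Z \<omega> ^ 3)))"
      by (intro Bochner_Integration.integrable_diff integrable_const integrable_const_bound[where B=1]) auto
    fix \<omega>
    have "cos (\<delta> * exp (Z \<omega> ^ 3)) \<le> 0" if "a \<le> Z \<omega>" "Z \<omega> \<le> b"
    proof (rule cos_le_0)
      have "a ^ 3 \<le> Z \<omega> ^ 3" "Z \<omega> ^ 3 \<le> b ^ 3"
        using that \<open>0 \<le> a\<close> by (auto intro!: power_mono)
      then have "exp (a ^ 3) \<le> exp (Z \<omega> ^ 3)" "exp (Z \<omega> ^ 3) \<le> exp (b ^ 3)" by simp_all
      moreover have "exp (a ^ 3) = pi / (2 * \<delta>)" "exp (b ^ 3) = 3 * pi / (2 * \<delta>)"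
        unfolding a3 b by (rule exp_ln, use \<delta> in simp)+
      ultimately have "pi / (2 * \<delta>) \<le> exp (Z \<omega> ^ 3)" "exp (Z \<omega> ^ 3) \<le> 3 * pi / (2 * \<delta>)"
        by simp_all
      then show "pi / 2 \<le> \<delta> * exp (Z \<omega> ^ 3)" "\<delta> * exp (Z \<omega> ^ 3) \<le> 3 * pi / 2"
        using \<delta> by (simp_all add: field_simps)
    qed
    then show "indicator (Z -` {a..b} \<inter> space M) \<omega> \<le> 1 - cos (\<delta> * exp (Z \<omega> ^ 3))"
      by (auto simp: indicator_def)
  qed
  also have "\<dots> = 1 - expectation (\<lambda>\<omega>. cos (\<delta> * exp (Z \<omega> ^ 3)))"
    by (subst Bochner_Integration.integral_diff) (auto simp: prob_space intro!: integrable_const_bound[where B=1])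
  finally show ?thesis by simp
qed

subsection \<open>Euler scheme along a path\<close>

lemma drift_measurable [measurable]: "drift \<in> borel_measurable borel"
proof (rule borel_measurable_vecI)
  fix i :: 4
  show "(\<lambda>x. drift x $ i) \<in> borel_measurable borel"
    using exhaust_4[of i] by (elim disjE) (simp_all add: drift_nth)
qed

lemma euler_maruyama_0 [simp]: "euler_maruyama f A W h 0 \<omega> = 0"
  by (simp add: euler_maruyama.simps)

lemma euler_maruyama_step:
  assumes "0 < h" "s = real n * h" "s < t" "t \<le> s + h"
  shows "euler_maruyama f A W h t \<omega> =
    euler_maruyama f A W h s \<omega> + (t - s) *\<^sub>R f (euler_maruyama f A W h s \<omega>) + A *v (W t \<omega> - W s \<omega>)"
proof -
  have "left_grid h t = s"
    unfolding \<open>s = real n * h\<close> using assms by (intro left_grid_eq) (auto simp: algebra_simps)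
  moreover have "0 \<le> s" using assms by simp
  then have "0 < t" using \<open>s < t\<close> by simp
  ultimately show ?thesis using \<open>0 < h\<close> by (subst euler_maruyama.simps) simp
qed

text \<open>Induction over the grid that reaches every real time: the last step may be partial.
  Cells are open on the left and closed on the right, in agreement with
  \<open>left_grid\<close>.\<close>

lemma grid_induct [consumes 2, case_names zero step]:
  fixes h t :: real
  assumes "0 < h" "0 \<le> t" "P 0"
    and step: "\<And>n s t. s = real n * h \<Longrightarrow> 0 \<le> s \<Longrightarrow> s < t \<Longrightarrow> t \<le> s + h \<Longrightarrow> P s \<Longrightarrow> P t"
  shows "P t"
proof -
  have grid: "P (real n * h)" for n
  proof (induction n)
    case (Suc n)
    show ?case by (rule step[OF refl _ _ _ Suc]) (use \<open>0 < h\<close> in \<open>auto simp: algebra_simps\<close>)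
  qed (simp add: \<open>P 0\<close>)
  show ?thesis
  proof (cases "t = 0")
    case False
    \<comment> \<open>With the ceiling minus 1, a time on the grid counts as the right end of the
      preceding cell.\<close>
    define n where "n = nat (\<lceil>t / h\<rceil> - 1)"
    have "0 < t / h" using False assms by simp
    then have "real n = of_int \<lceil>t / h\<rceil> - 1" by (simp add: n_def)
    then have "real n < t / h" "t / h \<le> real n + 1"
      using ceiling_correct[of "t / h"] by linarith+
    then have "real n * h < t" "t \<le> real n * h + h"
      using \<open>0 < h\<close> by (simp_all add: field_simps)
    then show ?thesis using step[OF refl _ _ _ grid[of n]] \<open>0 < h\<close> by simp
  qed (simp add: \<open>P 0\<close>)
qed

text \<open>These facts concern single paths: \<open>W\<close> is an arbitrary function of time and
  \<open>\<omega>\<close>, so a zero driver is also an instance.\<close>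

locale euler_scheme =
  fixes W :: "real \<Rightarrow> 'a \<Rightarrow> real ^ 4" and h :: real
  assumes h_pos: "0 < h"
begin

abbreviation Y :: "real \<Rightarrow> 'a \<Rightarrow> real ^ 4" where
  "Y \<equiv> euler_maruyama drift diffusion W h"

lemma step:
  assumes "s = real n * h" "s < t" "t \<le> s + h"
  shows "Y t \<omega> $ 1 = Y s \<omega> $ 1 + (t - s) * (switch_on (Y s \<omega> $ 4) * cos ((Y s \<omega> $ 3 - C_hat) * exp ((Y s \<omega> $ 2) ^ 3)))"
    "Y t \<omega> $ 2 = Y s \<omega> $ 2 + (W t \<omega> $ 2 - W s \<omega> $ 2)"
    "Y t \<omega> $ 3 = Y s \<omega> $ 3 + (t - s) * switch_off (Y s \<omega> $ 4)"
    "Y t \<omega> $ 4 = Y s \<omega> $ 4 + (t - s)"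
  unfolding euler_maruyama_step[OF h_pos assms] by (simp_all add: drift_nth diffusion_mult vector_4_nth)

lemma Y4: "0 \<le> t \<Longrightarrow> Y t \<omega> $ 4 = t"
  using h_pos by (induction t rule: grid_induct) (auto simp: step)

text \<open>The scheme starts at 0 on every path, whereas \<open>W 0\<close> is 0 only almost
  surely; hence the subtraction.\<close>

lemma Y2: "0 \<le> t \<Longrightarrow> Y t \<omega> $ 2 = W t \<omega> $ 2 - W 0 \<omega> $ 2"
  using h_pos by (induction t rule: grid_induct) (auto simp: step)

text \<open>The noise never enters the third coordinate. Running the scheme with a zero driver over
  the one-point type \<open>unit\<close> presents that coordinate as a function of time
  alone.\<close>

definition Y3 :: "real \<Rightarrow> real" where
  "Y3 t = euler_maruyama drift diffusion (\<lambda>_ (_::unit). 0 :: real ^ 4) h t () $ 3"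

lemma Y3_0 [simp]: "Y3 0 = 0" by (simp add: Y3_def)

lemma Y3_step:
  assumes "s = real n * h" "s < t" "t \<le> s + h"
  shows "Y3 t = Y3 s + (t - s) * switch_off s"
proof -
  interpret Z: euler_scheme "\<lambda>_ (_::unit). 0 :: real ^ 4" h by standard (fact h_pos)
  have "0 \<le> s" using assms h_pos by simp
  then show ?thesis unfolding Y3_def by (simp add: Z.step[OF assms] Z.Y4)
qed

lemma Y3: "0 \<le> t \<Longrightarrow> Y t \<omega> $ 3 = Y3 t"
  using h_pos by (induction t rule: grid_induct) (auto simp: step Y3_step Y4)

lemma Y1_step:
  assumes "s = real n * h" "s < t" "t \<le> s + h"
  shows "Y t \<omega> $ 1 = Y s \<omega> $ 1 + (t - s) * (switch_on s * cos ((Y3 s - C_hat) * exp ((W s \<omega> $ 2 - W 0 \<omega> $ 2) ^ 3)))"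
proof -
  have "0 \<le> s" using assms h_pos by simp
  then show ?thesis by (simp add: step[OF assms] Y2 Y3 Y4)
qed

text \<open>A left sum of a decreasing function overestimates its integral. The error of one step is
  at most \<open>h\<close> times the drop of \<open>switch_off\<close> across it, and these drops
  telescope.\<close>

lemma Y3_bounds:
  assumes "0 \<le> t"
  shows "0 \<le> Y3 t - int_off t \<and> Y3 t - int_off t \<le> h * (switch_off 0 - switch_off t)"
  using h_pos assms
proof (induction t rule: grid_induct)
  case (step n s t)
  have "(t - s) * (switch_off s - switch_off t) \<le> h * (switch_off s - switch_off t)"
    using step by (intro mult_right_mono) (auto simp: switch_off_antimono)
  then show ?case
    using step int_off_bounds[of s t] by (auto simp: Y3_step[OF step(1,3,4)] algebra_simps)
qed auto

lemma Y3_error: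
  assumes "0 \<le> t" shows "\<bar>Y3 t - int_off t\<bar> \<le> h"
proof -
  have "h * (switch_off 0 - switch_off t) \<le> h * 1"
    using h_pos switch_off_le_1[of 0] switch_off_nonneg[of t] by (intro mult_left_mono) linarith+
  then show ?thesis using Y3_bounds[OF assms] by simp
qed

text \<open>The overshoot never decreases, and each full step inside [1/4, 3/4] adds at least h^2 /
  216. The bracket measures the time covered by such steps: it is nonpositive while no such step has
  been made, grows by at most \<open>h\<close> per step, and stays constant once a step ends beyond
  3/4.\<close>

lemma Y3_lower_grid:
  "h / 216 * (min (real n * h) (3 / 4 - h) - 1 / 4 - h) \<le> Y3 (real n * h) - int_off (real n * h)"
proof (induction n)
  case 0
  show ?case using h_pos by (auto simp: min_def mult_le_0_iff)
next
  case (Suc n)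
  define s where "s = real n * h"
  have st: "real (Suc n) * h = s + h" by (simp add: s_def algebra_simps)
  have "0 \<le> s" using h_pos by (simp add: s_def)
  have Y3: "Y3 (s + h) = Y3 s + h * switch_off s"
    using Y3_step[of s n "s + h"] h_pos by (simp add: s_def)
  have IH: "h / 216 * (min s (3 / 4 - h) - 1 / 4 - h) \<le> Y3 s - int_off s"
    using Suc by (simp add: s_def)
  have ?case if "s < 1 / 4"
  proof -
    \<comment> \<open>This step may cross 1/4; subtracting \<open>h\<close> in the bracket keeps the
      claimed bound trivial there.\<close>
    have "min (s + h) (3 / 4 - h) - 1 / 4 - h \<le> 0" using that h_pos by (simp add: min_def)
    then have "h / 216 * (min (s + h) (3 / 4 - h) - 1 / 4 - h) \<le> 0"
      using h_pos by (intro mult_nonneg_nonpos) auto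
    then show ?thesis unfolding st
      using Y3_bounds[of "s + h"] h_pos \<open>0 \<le> s\<close> by linarith
  qed
  moreover have ?case if "1 / 4 \<le> s" "s + h \<le> 3 / 4"
  proof -
    have "min (s + h) (3 / 4 - h) \<le> min s (3 / 4 - h) + h" using h_pos by (simp add: min_def)
    then have "h / 216 * (min (s + h) (3 / 4 - h) - 1 / 4 - h) \<le> h / 216 * ((min s (3 / 4 - h) - 1 / 4 - h) + h)"
      using h_pos by (intro mult_left_mono) linarith+
    also have "\<dots> = h / 216 * (min s (3 / 4 - h) - 1 / 4 - h) + h\<^sup>2 / 216"
      by (simp add: algebra_simps power2_eq_square)
    finally show ?thesis
      unfolding st Y3 using IH int_off_step_error[OF that] h_pos by linarith
  qed
  moreover have ?case if "3 / 4 < s + h"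
  proof -
    have min: "min (s + h) (3 / 4 - h) = min s (3 / 4 - h)" using that h_pos by simp
    have "int_off (s + h) - int_off s \<le> h * switch_off s"
      using int_off_bounds(2)[of s "s + h"] h_pos \<open>0 \<le> s\<close> by simp
    then show ?thesis unfolding st Y3 min using IH by linarith
  qed
  ultimately show ?case by linarith
qed

text \<open>For s \<ge> 1 the bracket in \<open>Y3_lower_grid\<close> equals 1/2 - 2 * h, which is
  at least 9/22 and so exceeds 216/600.\<close>

lemma Y3_lower:
  assumes "h \<le> 1 / 22" "s = real n * h" "1 \<le> s"
  shows "h / 600 \<le> Y3 s - C_hat"
proof -
  have "h / 600 \<le> h / 216 * (min s (3 / 4 - h) - 1 / 4 - h)"
    using assms h_pos by (simp add: min_def)
  then show ?thesis
    using Y3_lower_grid[of n] int_off_eq_C_hat[of s] assms by simp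
qed

section \<open>The first coordinate along a path\<close>

lemma Y1_bound: "0 \<le> t \<Longrightarrow> \<bar>Y t \<omega> $ 1\<bar> \<le> t"
  using h_pos
proof (induction t rule: grid_induct)
  case (step n s t)
  define d where "d = (t - s) * (switch_on s * cos ((Y3 s - C_hat) * exp ((W s \<omega> $ 2 - W 0 \<omega> $ 2) ^ 3)))"
  have "\<bar>switch_on s * cos x\<bar> \<le> 1 * 1" for x
    unfolding abs_mult by (intro mult_mono) auto
  then have "\<bar>d\<bar> \<le> (t - s) * 1"
    unfolding d_def abs_mult[of "t - s"] using step by (intro mult_mono) auto
  then show ?case unfolding Y1_step[OF step(1,3,4)] d_def[symmetric] using step(5) by simp
qed simp

text \<open>Two sources of error: the left sum of the increasing \<open>switch_on\<close>, whose
  step errors telescope to \<open>h * switch_on t\<close>, and the cosine factor, where 1 - cos x is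
  at most the absolute value of x. The constant depends on the path through its bound
  \<open>R\<close>.\<close>

lemma Y1_pathwise:
  assumes "0 \<le> t" "\<And>s. 0 \<le> s \<Longrightarrow> s \<le> t \<Longrightarrow> \<bar>W s \<omega> $ 2 - W 0 \<omega> $ 2\<bar> \<le> R"
  shows "\<bar>int_on t - Y t \<omega> $ 1\<bar> \<le> h * switch_on t + t * (h * exp (R ^ 3))"
  using h_pos assms
proof (induction t rule: grid_induct)
  case (step n s t)
  define x where "x = (Y3 s - C_hat) * exp ((W s \<omega> $ 2 - W 0 \<omega> $ 2) ^ 3)"
  have 1: "\<bar>switch_on s * (1 - cos x)\<bar> \<le> h * exp (R ^ 3)"
  \<comment> \<open>Up to time 1 the third coordinate need not be near \<open>C_hat\<close>, but
    there \<open>switch_on\<close> vanishes.\<close>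
  proof (cases "s \<le> 1")
    case False
    have "\<bar>Y3 s - C_hat\<bar> \<le> h" using False Y3_error[of s] int_off_eq_C_hat[of s] by simp
    moreover have "W s \<omega> $ 2 - W 0 \<omega> $ 2 \<le> R" using step.prems[of s] step.hyps by simp
    then have "exp ((W s \<omega> $ 2 - W 0 \<omega> $ 2) ^ 3) \<le> exp (R ^ 3)" by (auto intro: power_mono_odd)
    ultimately have x: "\<bar>x\<bar> \<le> h * exp (R ^ 3)"
      unfolding x_def abs_mult by (intro mult_mono) auto
    have "\<bar>1 - cos x\<bar> \<le> \<bar>x\<bar>"
    proof -
      have "1 - cos x = 2 * (sin (x / 2))\<^sup>2" using cos_double_sin[of "x / 2"] by simp
      also have "\<dots> \<le> 2 * \<bar>sin (x / 2)\<bar>"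
        using mult_right_mono[OF abs_sin_le_one[of "x / 2"], of "\<bar>sin (x / 2)\<bar>"]
        by (simp add: power2_eq_square flip: abs_mult)
      also have "\<dots> \<le> \<bar>x\<bar>" using abs_sin_x_le_abs_x[of "x / 2"] by simp
      finally show ?thesis using cos_le_one[of x] by simp
    qed
    moreover have "\<bar>switch_on s\<bar> * \<bar>1 - cos x\<bar> \<le> 1 * \<bar>1 - cos x\<bar>"
      by (intro mult_right_mono) auto
    ultimately show ?thesis using x unfolding abs_mult by simp
  qed (use h_pos in \<open>simp add: switch_on_eq_0\<close>)
  have IH: "\<bar>int_on s - Y s \<omega> $ 1\<bar> \<le> h * switch_on s + s * (h * exp (R ^ 3))"
    using step by auto
  \<comment> \<open>Earlier error, plus quadrature error of this step, plus loss through the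
    cosine.\<close>
  have "int_on t - Y t \<omega> $ 1 = (int_on s - Y s \<omega> $ 1) + (int_on t - int_on s - (t - s) * switch_on s)
      + (t - s) * (switch_on s * (1 - cos x))"
    unfolding Y1_step[OF step(1,3,4)] x_def by (simp add: algebra_simps)
  moreover have "\<bar>int_on t - int_on s - (t - s) * switch_on s\<bar> \<le> (t - s) * (switch_on t - switch_on s)"
    using int_on_bounds[of s t] step by (simp add: algebra_simps)
  moreover have "\<dots> \<le> h * (switch_on t - switch_on s)"
    using step by (intro mult_right_mono) (auto simp: switch_on_mono)
  moreover have "\<bar>(t - s) * (switch_on s * (1 - cos x))\<bar> \<le> (t - s) * (h * exp (R ^ 3))"
    using 1 step unfolding abs_mult[of "t - s"] by (intro mult_mono) auto
  ultimately show ?case using IH by (simp add: algebra_simps)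
qed (simp add: switch_on_def)

lemma Y_measurable:
  assumes W: "\<And>t. 0 \<le> t \<Longrightarrow> W t \<in> borel_measurable M" and "0 \<le> t"
  shows "Y t \<in> borel_measurable M"
  using h_pos \<open>0 \<le> t\<close>
proof (induction t rule: grid_induct)
  case zero
  have "Y 0 = (\<lambda>_. 0)" by auto
  then show ?case by simp
next
  case (step n s t)
  have "0 \<le> t" using step(2,3) by linarith
  note [measurable] = step(5) W[OF \<open>0 \<le> s\<close>] W[OF \<open>0 \<le> t\<close>]
  have [measurable]: "(\<lambda>\<omega>. diffusion *v (W t \<omega> - W s \<omega>)) \<in> borel_measurable M"
    by (intro borel_measurable_continuous_on[OF matrix_vector_mult_linear_continuous_on]) measurable
  have "Y t = (\<lambda>\<omega>. Y s \<omega> + (t - s) *\<^sub>R drift (Y s \<omega>) + diffusion *v (W t \<omega> - W s \<omega>))"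
    using euler_maruyama_step[OF h_pos step(1,3,4)] by (intro ext)
  then show ?case by simp
qed

end

subsection \<open>The exact solution\<close>

lemma integral_vec_nth:
  fixes f :: "'a \<Rightarrow> real ^ 'd"
  shows "integrable M f \<Longrightarrow> integral\<^sup>L M f $ i = (\<integral>x. f x $ i \<partial>M)"
  by (rule integral_bounded_linear[OF bounded_linear_vec_nth, symmetric])

lemma integrable_vecI:
  fixes f :: "'a \<Rightarrow> real ^ 'd"
  assumes "\<And>i. integrable M (\<lambda>x. f x $ i)"
  shows "integrable M f"
proof (rule Bochner_Integration.integrable_bound)
  show "integrable M (\<lambda>x. \<Sum>i\<in>UNIV. \<bar>f x $ i\<bar>)"
    using assms by (intro Bochner_Integration.integrable_sum integrable_abs)
  show "f \<in> borel_measurable M"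
    using assms by (intro borel_measurable_vecI borel_measurable_integrable)
  show "AE x in M. norm (f x) \<le> norm (\<Sum>i\<in>UNIV. \<bar>f x $ i\<bar>)"
    using norm_le_l1_cart[of "f _"] by (auto simp: sum_nonneg)
qed

lemma norm_drift_le: "norm (drift x) \<le> 3"
proof -
  have "\<bar>drift x $ 1\<bar> \<le> 1 * 1" unfolding drift_nth abs_mult by (intro mult_mono) auto
  moreover have "(\<Sum>i\<in>UNIV. \<bar>drift x $ i\<bar>) = \<bar>drift x $ 1\<bar> + switch_off (x $ 4) + 1"
    by (simp add: sum_4 drift_nth(2-4))
  ultimately show ?thesis using switch_off_le_1[of "x $ 4"] norm_le_l1_cart[of "drift x"] by linarith
qed

text \<open>The system is solved from the bottom up: the fourth coordinate is time, which determines
  the third. After time 1 the third equals \<open>C_hat\<close>, so the cosine is 1 whatever the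
  second coordinate does, and the first coordinate becomes the integral of
  \<open>switch_on\<close>.\<close>

lemma sde_solution:
  assumes x: "continuous_on {0..} x" and eq: "\<And>t. 0 \<le> t \<Longrightarrow> x t = (LBINT s=0..t. drift (x s)) + diffusion *v w t"
    and "0 \<le> t"
  shows "x t = vector [int_on t, w t $ 2, int_off t, t]"
proof -
  have int: "interval_lebesgue_integrable lborel (ereal 0) (ereal t) (\<lambda>s. drift (x s))" if "0 \<le> t" for t
  proof (rule interval_integrable_bounded)
    have "continuous_on {0<..<t} x" using x by (rule continuous_on_subset) auto
    then have [measurable]: "(\<lambda>s. indicator {0<..<t} s *\<^sub>R x s) \<in> borel_measurable borel"
      by (intro borel_measurable_continuous_on_indicator) auto
    \<comment> \<open>The path is only known to be continuous for nonnegative times. Extending it by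
      0 outside the open interval makes it Borel on the whole line, and the outer indicator hides
      the extension.\<close>
    have "(\<lambda>s. indicator {0<..<t} s *\<^sub>R drift (indicator {0<..<t} s *\<^sub>R x s)) \<in> borel_measurable borel"
      by measurable
    then show "set_borel_measurable borel {0<..<t} (\<lambda>s. drift (x s))"
      unfolding set_borel_measurable_def by (rule measurable_cong[THEN iffD1, rotated]) (auto simp: indicator_def)
  qed (use that norm_drift_le in auto)
  have nth: "(LBINT s=0..t. drift (x s)) $ i = (LBINT s=0..t. drift (x s) $ i)" if "0 \<le> t" for t :: real and i
    using int[OF that] that
    by (simp add: interval_lebesgue_integral_def interval_lebesgue_integrable_def set_lebesgue_integral_def
        set_integrable_def integral_vec_nth zero_ereal_def)
  have cong: "(LBINT s=0..t. f s) = (LBINT s=0..t. g s)" if "0 \<le> t" "\<And>s. 0 < s \<Longrightarrow> s < t \<Longrightarrow> f s = g s"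
    for t :: real and f g :: "real \<Rightarrow> real"
    using that by (intro interval_integral_cong) (auto simp: einterval_iff zero_ereal_def)
  have x: "x t $ i = (LBINT s=0..t. drift (x s) $ i) + (vector [0, w t $ 2, 0, 0] :: real ^ 4) $ i"
    if "0 \<le> t" for t i
    by (subst eq[OF that]) (simp add: nth[OF that] diffusion_mult)
  have x4: "x t $ 4 = t" if "0 \<le> t" for t
    using interval_integral_const(2)[of 0 t 1] x[OF that, of 4]
    by (simp add: drift_nth vector_4_nth zero_ereal_def)
  have x3: "x t $ 3 = int_off t" if "0 \<le> t" for t
    using cong[OF that, of "\<lambda>s. drift (x s) $ 3" switch_off] x[OF that, of 3]
    by (simp add: drift_nth vector_4_nth int_off_def x4)
  have x1: "x t $ 1 = int_on t" if "0 \<le> t" for t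
  proof -
    have "drift (x s) $ 1 = switch_on s" if "0 < s" for s
      using that by (cases "s \<le> 1") (simp_all add: drift_nth x4 x3 switch_on_eq_0 int_off_eq_C_hat)
    then show ?thesis
      using cong[OF that, of "\<lambda>s. drift (x s) $ 1" switch_on] x[OF that, of 1]
      by (simp add: vector_4_nth int_on_def)
  qed
  have x2: "x t $ 2 = w t $ 2"
    using x[OF \<open>0 \<le> t\<close>, of 2] by (simp add: drift_nth vector_4_nth)
  show ?thesis
    using \<open>0 \<le> t\<close> by (simp add: vec_eq_iff forall_4 vector_4_nth x1 x2 x3 x4)
qed

subsection \<open>Expectations\<close>

lemma five_halves_power_le_exp: "(5 / 2) ^ n \<le> exp (real n)"
proof -
  have "5 / 2 \<le> exp (1 :: real)" using exp_lower_Taylor_quadratic[of 1] by simp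
  then show ?thesis using power_mono[of "5 / 2" "exp (1 :: real)" n] exp_of_nat_mult[of n "1::real"] by simp
qed

lemma abs_ln_ge_2:
  fixes h :: real
  assumes "0 < h" "h \<le> 1 / 22"
  shows "2 \<le> \<bar>ln h\<bar>"
proof -
  have "exp (2::real) \<le> 22" using exp_of_nat_le[of 2] by simp
  also have "22 \<le> 1 / h" using assms by (simp add: field_simps)
  finally have "2 \<le> ln (1 / h)" using assms by (subst ln_ge_iff) auto
  then show ?thesis using assms by (simp add: ln_div)
qed

text \<open>With L = -ln h the argument of the logarithm is at most 6 / \<delta> \<le> 3600 / h
  \<le> exp (9 + L), where (5/2)^9 exceeds 3600. Since L \<ge> 2, also 9 + L \<le> 8 * L, whence b
  \<le> 2 * L powr (1/3).\<close>

lemma cube_log_bound: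
  fixes h \<delta> b :: real
  assumes h: "0 < h" "h \<le> 1 / 22" and \<delta>: "h / 600 \<le> \<delta>" "\<delta> \<le> 1" and b: "b ^ 3 = ln (3 * pi / (2 * \<delta>))"
  shows "b\<^sup>2 \<le> 4 * \<bar>ln h\<bar> powr (2 / 3)"
proof -
  define L where "L = \<bar>ln h\<bar>"
  have L: "2 \<le> L" "ln h = - L" using abs_ln_ge_2[OF h] h by (simp_all add: L_def)
  have "0 < \<delta>" using h \<delta> by (auto intro: less_le_trans[of _ "h / 600"])
  have "1 \<le> 3 * pi / (2 * \<delta>)" using \<delta> \<open>0 < \<delta>\<close> pi_ge_two by (simp add: field_simps)
  then have "0 \<le> b ^ 3" by (simp add: b)
  then have "0 \<le> b" by (simp add: zero_le_odd_power)
  have "3 * pi / (2 * \<delta>) \<le> 6 / \<delta>" using pi_less_4 \<open>0 < \<delta>\<close> by (simp add: field_simps)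
  also have "\<dots> \<le> 6 / (h / 600)" using h \<delta> \<open>0 < \<delta>\<close> by (intro divide_left_mono) auto
  also have "\<dots> \<le> exp 9 / h"
    using h five_halves_power_le_exp[of 9] by (simp add: divide_right_mono power_divide)
  also have "\<dots> = exp (9 + L)"
  proof -
    have "h = exp (- L)" using L(2) h exp_ln[of h] by simp
    then show ?thesis by (simp add: exp_add exp_minus divide_inverse)
  qed
  finally have "ln (3 * pi / (2 * \<delta>)) \<le> ln (exp (9 + L))"
    using \<open>0 < \<delta>\<close> by (subst ln_le_cancel_iff) auto
  then have "b ^ 3 \<le> 8 * L" using L by (simp add: b)
  also have "\<dots> = (2 * L powr (1 / 3)) ^ 3"
  proof -
    have "(L powr (1 / 3)) ^ 3 = L" using L by (simp add: powr_powr flip: powr_numeral)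
    then show ?thesis by (simp add: power_mult_distrib)
  qed
  finally have "b \<le> 2 * L powr (1 / 3)"
    using \<open>0 \<le> b\<close> by (subst (asm) power_mono_iff) auto
  then have "b\<^sup>2 \<le> (2 * L powr (1 / 3))\<^sup>2" using \<open>0 \<le> b\<close> by (rule power_mono)
  also have "\<dots> = 4 * L powr (2 / 3)"
  proof -
    have "(L powr (1 / 3))\<^sup>2 = L powr (2 / 3)" using L by (simp add: powr_powr flip: powr_numeral)
    then show ?thesis by (simp add: power_mult_distrib)
  qed
  finally show ?thesis by (simp add: L_def)
qed

section \<open>The mean error of the first coordinate\<close>

locale brownian = prob_space M for M :: "'a measure" +
  fixes W :: "real \<Rightarrow> 'a \<Rightarrow> real ^ 4"
  assumes brownian: "std_brownian_motion M W"
begin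

abbreviation Y :: "real \<Rightarrow> real \<Rightarrow> 'a \<Rightarrow> real ^ 4" where
  "Y \<equiv> euler_maruyama drift diffusion W"

lemma W_measurable: "0 \<le> t \<Longrightarrow> W t \<in> borel_measurable M"
  using brownian by (simp add: std_brownian_motion_def)

lemma W_distributed:
  "0 < t \<Longrightarrow> distributed M lborel (\<lambda>\<omega>. W t \<omega> $ 2 - W 0 \<omega> $ 2) (normal_density 0 (sqrt t))"
  using std_brownian_motion_nth[OF brownian, of 0 t 2] by simp

lemma W_integrable: "0 \<le> t \<Longrightarrow> integrable M (\<lambda>\<omega>. W t \<omega> $ 2 - W 0 \<omega> $ 2)"
  using integrable_normal_distributed[OF W_distributed] by (cases "t = 0") auto

lemma Y_nth_integrable:
  assumes "0 < h" "0 \<le> t"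
  shows "integrable M (\<lambda>\<omega>. Y h t \<omega> $ i)"
proof -
  interpret E: euler_scheme W h by standard fact
  have [measurable]: "Y h t \<in> borel_measurable M"
    by (rule E.Y_measurable) (simp_all add: W_measurable assms)
  have "integrable M (\<lambda>\<omega>. Y h t \<omega> $ 1)"
    using E.Y1_bound[OF \<open>0 \<le> t\<close>] by (intro integrable_const_bound[where B=t]) auto
  then show ?thesis
    using exhaust_4[of i] W_integrable[OF \<open>0 \<le> t\<close>] by (elim disjE) (simp_all add: E.Y2 E.Y3 E.Y4 \<open>0 \<le> t\<close>)
qed

lemma Y_integrable: "0 < h \<Longrightarrow> 0 \<le> t \<Longrightarrow> integrable M (Y h t)"
  by (intro integrable_vecI Y_nth_integrable)

text \<open>The exact first coordinate is almost surely the deterministic \<open>int_on t\<close>,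
  so this is its mean error.\<close>

definition gap :: "real \<Rightarrow> real \<Rightarrow> real" where
  "gap h t = int_on t - expectation (\<lambda>\<omega>. Y h t \<omega> $ 1)"

text \<open>As \<open>switch_on\<close> increases, the exact increment is at least the left-endpoint
  one; the scheme replaces the latter by its product with a cosine.\<close>

lemma gap_step:
  assumes "0 < h" "s = real n * h" "s < t" "t \<le> s + h"
  shows "gap h s + (t - s) * switch_on s *
    (1 - expectation (\<lambda>\<omega>. cos ((euler_scheme.Y3 h s - C_hat) * exp ((W s \<omega> $ 2 - W 0 \<omega> $ 2) ^ 3)))) \<le> gap h t"
proof -
  interpret E: euler_scheme W h by standard fact
  have "0 \<le> s" using assms by simp
  let ?c = "\<lambda>\<omega>. cos ((E.Y3 s - C_hat) * exp ((W s \<omega> $ 2 - W 0 \<omega> $ 2) ^ 3))"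
  note [measurable] = W_measurable[OF \<open>0 \<le> s\<close>] W_measurable[of 0, simplified]
  have c: "integrable M ?c" by (intro integrable_const_bound[where B=1]) auto
  have "expectation (\<lambda>\<omega>. Y h t \<omega> $ 1) = expectation (\<lambda>\<omega>. Y h s \<omega> $ 1) + (t - s) * (switch_on s * expectation ?c)"
    using c Y_nth_integrable[OF \<open>0 < h\<close> \<open>0 \<le> s\<close>] by (simp add: E.Y1_step[OF assms(2-4)])
  then show ?thesis using int_on_bounds(1)[of s t] \<open>s < t\<close> by (simp add: gap_def algebra_simps)
qed

text \<open>The gap never shrinks, and a step starting in [3/2, 2] enlarges it in proportion to its
  length. The factor collects exp (-1) from \<open>switch_on_lower\<close> and the window
  probability, whose exponent 4/3 * b^2 is at most 16/3 * L powr (2/3) with L the absolute value of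
  ln h. Subtracting \<open>h\<close> allows for the cell that crosses 3/2, where nonnegativity of
  the gap suffices.\<close>

lemma gap_lower:
  assumes "0 < h" "h \<le> 1 / 22" "0 \<le> t"
  shows "0 \<le> gap h t \<and> exp (- 1 - 16 / 3 * \<bar>ln h\<bar> powr (2 / 3)) / 12 * (min t 2 - 3 / 2 - h) \<le> gap h t"
  using assms(1,3)
proof (induction t rule: grid_induct)
  case zero
  show ?case using \<open>0 < h\<close> mult_nonneg_nonpos[of "exp _" "- (3 / 2) - h"] by (auto simp: gap_def)
next
  case (step n s t)
  interpret E: euler_scheme W h by standard fact
  let ?p = "1 - expectation (\<lambda>\<omega>. cos ((E.Y3 s - C_hat) * exp ((W s \<omega> $ 2 - W 0 \<omega> $ 2) ^ 3)))"
  let ?c = "exp (- 1 - 16 / 3 * \<bar>ln h\<bar> powr (2 / 3)) / 12"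
  have gap: "gap h s + (t - s) * switch_on s * ?p \<le> gap h t"
    by (rule gap_step[OF \<open>0 < h\<close>]) (use step in auto)
  have "0 \<le> ?p"
    using W_measurable[OF \<open>0 \<le> s\<close>] W_measurable[of 0]
    by (auto intro!: integral_le_const integrable_const_bound[where B=1])
  then have "0 \<le> (t - s) * switch_on s * ?p" using step(3) by (intro mult_nonneg_nonneg) auto
  then have mono: "gap h s \<le> gap h t" using gap by linarith
  have "?c * (min t 2 - 3 / 2 - h) \<le> gap h t"
  proof (cases "3 / 2 \<le> s \<and> s \<le> 2")
    case True
    define \<delta> where "\<delta> = E.Y3 s - C_hat"
    define b where "b = root 3 (ln (3 * pi / (2 * \<delta>)))"
    have b3: "b ^ 3 = ln (3 * pi / (2 * \<delta>))" by (simp add: b_def odd_real_root_pow)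
    \<comment> \<open>After time 1 the overshoot is measured against \<open>C_hat\<close>; it is at
      most \<open>h\<close>, hence below 1.\<close>
    have \<delta>: "h / 600 \<le> \<delta>" "\<delta> \<le> 1"
      using E.Y3_lower[OF assms(2) step(1)] E.Y3_error[of s] True int_off_eq_C_hat[of s] assms(2) by (auto simp: \<delta>_def)
    have "exp (- (16 / 3 * \<bar>ln h\<bar> powr (2 / 3))) / 12 \<le> exp (- (4 / 3 * b\<^sup>2)) / 12"
      using cube_log_bound[OF \<open>0 < h\<close> assms(2) \<delta> b3] by simp
    also have "\<dots> \<le> ?p"
      using expectation_cos_le[OF W_distributed, of s \<delta> b] True \<delta> b3 \<open>0 < h\<close> by (simp add: \<delta>_def)
    finally have "exp (- 1) * (exp (- (16 / 3 * \<bar>ln h\<bar> powr (2 / 3))) / 12) \<le> switch_on s * ?p"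
      using True by (intro mult_mono switch_on_lower) auto
    then have "?c \<le> switch_on s * ?p"
      by (simp add: mult_exp_exp)
    then have "(t - s) * ?c \<le> (t - s) * (switch_on s * ?p)"
      using step(3) by (intro mult_left_mono) auto
    then have incr: "?c * (t - s) \<le> (t - s) * switch_on s * ?p"
      by (simp only: mult.assoc mult.commute[of ?c])
    have "?c * (min t 2 - 3 / 2 - h) \<le> ?c * ((min s 2 - 3 / 2 - h) + (t - s))"
      using step(3) by (intro mult_left_mono) auto
    also have "\<dots> = ?c * (min s 2 - 3 / 2 - h) + ?c * (t - s)" by (rule distrib_left)
    also have "\<dots> \<le> gap h s + (t - s) * switch_on s * ?p"
      using step(5) incr by (intro add_mono) blast+
    also note gap
    finally show ?thesis .
  next
    case False
    show ?thesis
    proof (cases "s < 3 / 2")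
      case True
      then have "?c * (min t 2 - 3 / 2 - h) \<le> 0" using step(4) by (intro mult_nonneg_nonpos) auto
      then show ?thesis using mono step(5) by linarith
    next
      case False
      \<comment> \<open>Past time 2 the claimed bound no longer grows, so monotonicity of the gap is
        enough.\<close>
      then have "min t 2 = min s 2" using \<open>\<not> (3 / 2 \<le> s \<and> s \<le> 2)\<close> step(3) by simp
      then show ?thesis using mono step(5) by simp
    qed
  qed
  then show ?case using mono step(5) by simp
qed

lemma gap_ge_exp:
  assumes "0 < h" "h \<le> 1 / 22" "2 \<le> t"
  shows "exp (- 14 * \<bar>ln h\<bar> powr (2 / 3)) \<le> gap h t"
proof -
  let ?L = "\<bar>ln h\<bar> powr (2 / 3)"
  have L: "1 \<le> ?L"
    using abs_ln_ge_2[OF assms(1,2)] by (intro ge_one_powr_ge_zero) auto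
  \<comment> \<open>The constant is chosen so that 5/132 = (1/2 - 1/22) / 12. The exponents then fit
    because 1 + 4 \<le> (14 - 16/3) * L for L \<ge> 1, with L standing for
    \<open>?L\<close>.\<close>
  have "132 / 5 \<le> exp (4 :: real)"
    using five_halves_power_le_exp[of 4] by (simp add: power_divide)
  then have "exp (- 4 :: real) \<le> 5 / 132" by (simp add: exp_minus field_simps)
  have "exp (- 14 * ?L) \<le> exp (- 1 - 16 / 3 * ?L) * exp (- 4)"
    using L by (simp flip: exp_add)
  also have "\<dots> \<le> exp (- 1 - 16 / 3 * ?L) * (5 / 132)"
    using \<open>exp (- 4) \<le> 5 / 132\<close> by (intro mult_left_mono) auto
  also have "\<dots> = exp (- 1 - 16 / 3 * ?L) / 12 * (1 / 2 - 1 / 22)" by simp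
  also have "\<dots> \<le> exp (- 1 - 16 / 3 * ?L) / 12 * (min t 2 - 3 / 2 - h)"
    using assms by (intro mult_left_mono) auto
  also have "\<dots> \<le> gap h t" using gap_lower[of h t] assms by simp
  finally show ?thesis .
qed

text \<open>Dominated convergence along sequences: \<open>Y1_pathwise\<close> gives convergence on
  each path, and \<open>Y1_bound\<close> gives a constant dominating function.\<close>

lemma Y1_L1_convergence:
  assumes W: "continuous_paths M W" and "0 \<le> t"
  shows "((\<lambda>h. expectation (\<lambda>\<omega>. \<bar>int_on t - Y h t \<omega> $ 1\<bar>)) \<longlongrightarrow> 0) (at_right 0)"
  unfolding tendsto_at_iff_sequentially comp_def
proof (intro allI impI)
  fix H :: "nat \<Rightarrow> real"
  assume H: "\<forall>i. H i \<in> {0<..} - {0}" "H \<longlonglongrightarrow> 0"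
  have H_pos: "0 < H i" for i using H by auto
  have "(\<lambda>i. expectation (\<lambda>\<omega>. \<bar>int_on t - Y (H i) t \<omega> $ 1\<bar>)) \<longlonglongrightarrow> expectation (\<lambda>_. 0)"
  proof (rule integral_dominated_convergence)
    show "(\<lambda>\<omega>. \<bar>int_on t - Y (H i) t \<omega> $ 1\<bar>) \<in> borel_measurable M" for i
      using Y_nth_integrable[OF H_pos \<open>0 \<le> t\<close>] by measurable
    show "integrable M (\<lambda>_. \<bar>int_on t\<bar> + t)" by simp
    show "AE \<omega> in M. norm \<bar>int_on t - Y (H i) t \<omega> $ 1\<bar> \<le> \<bar>int_on t\<bar> + t" for i
    proof (rule AE_I2)
      fix \<omega>
      have "\<bar>Y (H i) t \<omega> $ 1\<bar> \<le> t"
        by (rule euler_scheme.Y1_bound[OF euler_scheme.intro[OF H_pos] \<open>0 \<le> t\<close>])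
      then show "norm \<bar>int_on t - Y (H i) t \<omega> $ 1\<bar> \<le> \<bar>int_on t\<bar> + t" by simp
    qed
    show "AE \<omega> in M. (\<lambda>i. \<bar>int_on t - Y (H i) t \<omega> $ 1\<bar>) \<longlonglongrightarrow> 0"
    proof (rule AE_I2)
      fix \<omega> assume "\<omega> \<in> space M"
      then have "continuous_on {0..t} (\<lambda>s. W s \<omega>)"
        using W by (auto simp: continuous_paths_def intro: continuous_on_subset)
      \<comment> \<open>Compactness of \<open>{0..t}\<close> bounds the path, by a constant
        \<open>R\<close> that may depend on \<open>\<omega>\<close>.\<close>
      then have "bounded ((\<lambda>s. W s \<omega> $ 2 - W 0 \<omega> $ 2) ` {0..t})"
        by (intro compact_imp_bounded compact_continuous_image continuous_intros) auto
      then obtain R where "\<forall>s\<in>{0..t}. \<bar>W s \<omega> $ 2 - W 0 \<omega> $ 2\<bar> \<le> R"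
        by (auto simp: bounded_iff)
      then have R: "\<bar>W s \<omega> $ 2 - W 0 \<omega> $ 2\<bar> \<le> R" if "0 \<le> s" "s \<le> t" for s
        using that by auto
      show "(\<lambda>i. \<bar>int_on t - Y (H i) t \<omega> $ 1\<bar>) \<longlonglongrightarrow> 0"
      proof (rule tendsto_sandwich[OF _ _ tendsto_const])
        show "\<forall>\<^sub>F i in sequentially. \<bar>int_on t - Y (H i) t \<omega> $ 1\<bar> \<le> H i * switch_on t + t * (H i * exp (R ^ 3))"
          by (intro always_eventually allI euler_scheme.Y1_pathwise euler_scheme.intro H_pos \<open>0 \<le> t\<close> R)
        have "(\<lambda>i. H i * switch_on t + t * (H i * exp (R ^ 3))) \<longlonglongrightarrow> 0 * switch_on t + t * (0 * exp (R ^ 3))"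
          using H by (intro tendsto_intros)
        then show "(\<lambda>i. H i * switch_on t + t * (H i * exp (R ^ 3))) \<longlonglongrightarrow> 0" by simp
      qed auto
    qed
  qed auto
  then show "(\<lambda>i. expectation (\<lambda>\<omega>. \<bar>int_on t - Y (H i) t \<omega> $ 1\<bar>)) \<longlonglongrightarrow> 0" by simp
qed

end

text \<open>With L = -ln h the quotient is exp (\<alpha> * L - 14 * L powr (2/3)) for small h, and
  the linear term wins.\<close>

lemma lower_rate_divergence:
  assumes "0 < (\<alpha>::real)"
  shows "filterlim (\<lambda>h. exp (- 14 * \<bar>ln h\<bar> powr (2 / 3)) / h powr \<alpha>) at_top (at_right 0)"
  using assms by real_asymp

theorem theorem5p1:
  fixes M :: "'a measure" and W X :: "real \<Rightarrow> 'a \<Rightarrow> real ^ 4"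
    and Y :: "real \<Rightarrow> real \<Rightarrow> 'a \<Rightarrow> real ^ 4"
  assumes "prob_space M"
    and "std_brownian_motion M W"
    and "continuous_paths M W"
    and "\<forall>t\<ge>0. X t \<in> borel_measurable M"
    and "continuous_paths M X"
    and "AE \<omega> in M. \<forall>t\<ge>0.
           X t \<omega> = (LBINT s=0..t. drift (X s \<omega>)) + diffusion *v W t \<omega>"
  defines "Y \<equiv> euler_maruyama drift diffusion W"
  shows "(\<forall>t\<ge>2. integrable M (X t) \<and> (\<forall>h>0. integrable M (Y h t)))
    \<and> (\<forall>h t. 0 < h \<and> h \<le> 1 / 22 \<and> 2 \<le> t \<longrightarrow>
          integral\<^sup>L M (\<lambda>\<omega>. X t \<omega> $ 1) - integral\<^sup>L M (\<lambda>\<omega>. Y h t \<omega> $ 1)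
            \<ge> exp (- 14 * \<bar>ln h\<bar> powr (2 / 3)))
    \<and> (\<forall>\<alpha>\<ge>0. \<forall>t\<ge>2.
          ((\<lambda>h. ereal (integral\<^sup>L M (\<lambda>\<omega>. norm (X t \<omega> - Y h t \<omega>)) / h powr \<alpha>))
             \<longlongrightarrow> (if \<alpha> = 0 then 0 else \<infinity>)) (at_right 0)
        \<and> ((\<lambda>h. ereal (norm (integral\<^sup>L M (X t) - integral\<^sup>L M (Y h t)) / h powr \<alpha>))
             \<longlongrightarrow> (if \<alpha> = 0 then 0 else \<infinity>)) (at_right 0))
    \<and> (\<forall>t\<ge>2. \<forall>\<alpha>>0. \<forall>C>0. \<forall>h\<^sub>0>0. \<exists>h\<in>{0<..<h\<^sub>0}.
          norm (integral\<^sup>L M (X t) - integral\<^sup>L M (Y h t)) > C * h powr \<alpha>)"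
proof -
  interpret prob_space M by fact
  interpret B: brownian M W by standard fact
  have "AE \<omega> in M. W 0 \<omega> = 0" using assms(2) by (simp add: std_brownian_motion_def)
  \<comment> \<open>Writing the second coordinate with \<open>W 0\<close> subtracted makes it
    literally equal to that of the scheme.\<close>
  then have "AE \<omega> in M. \<forall>t\<ge>0. X t \<omega> = vector [int_on t, W t \<omega> $ 2 - W 0 \<omega> $ 2, int_off t, t]"
    using assms(6) AE_space
  proof eventually_elim
    case (elim \<omega>)
    have "X t \<omega> = vector [int_on t, W t \<omega> $ 2, int_off t, t]" if "0 \<le> t" for t
      using sde_solution[of "\<lambda>t. X t \<omega>" "\<lambda>t. W t \<omega>" t] elim assms(5) that by (simp add: continuous_paths_def)
    then show ?case using elim by simp
  qed
  then have X: "AE \<omega> in M. X t \<omega> = vector [int_on t, W t \<omega> $ 2 - W 0 \<omega> $ 2, int_off t, t]" if "0 \<le> t" for t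
    using that by (auto elim: eventually_mono)
  have X_integrable: "integrable M (X t)" if "0 \<le> t" for t
  proof (subst integrable_cong_AE[OF _ _ X[OF that]])
    have 1: "integrable M (\<lambda>\<omega>. vector [int_on t, W t \<omega> $ 2 - W 0 \<omega> $ 2, int_off t, t] :: real ^ 4)"
    proof (rule integrable_vecI)
      fix i :: 4
      show "integrable M (\<lambda>\<omega>. (vector [int_on t, W t \<omega> $ 2 - W 0 \<omega> $ 2, int_off t, t] :: real ^ 4) $ i)"
        using exhaust_4[of i] B.W_integrable[OF that] by (elim disjE) (simp_all add: vector_4_nth)
    qed
    then show "integrable M (\<lambda>\<omega>. vector [int_on t, W t \<omega> $ 2 - W 0 \<omega> $ 2, int_off t, t] :: real ^ 4)"
      "(\<lambda>\<omega>. vector [int_on t, W t \<omega> $ 2 - W 0 \<omega> $ 2, int_off t, t] :: real ^ 4) \<in> borel_measurable M"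
      by simp_all
    show "X t \<in> borel_measurable M" using assms(4) that by simp
  qed
  have Y_int: "integrable M (Y h t)" if "0 < h" "0 \<le> t" for h t
    unfolding Y_def using that by (rule B.Y_integrable)
  have EX1: "expectation (\<lambda>\<omega>. X t \<omega> $ 1) = int_on t" if "0 \<le> t" for t
  proof -
    have "expectation (\<lambda>\<omega>. X t \<omega> $ 1) = expectation (\<lambda>\<omega>. int_on t)"
      using X[OF that] borel_measurable_integrable[OF X_integrable[OF that]]
      by (intro integral_cong_AE) (auto simp: vector_4_nth elim: eventually_mono)
    then show ?thesis by (simp add: prob_space)
  qed
  have lower: "exp (- 14 * \<bar>ln h\<bar> powr (2 / 3)) \<le> expectation (\<lambda>\<omega>. X t \<omega> $ 1) - expectation (\<lambda>\<omega>. Y h t \<omega> $ 1)"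
    if "0 < h" "h \<le> 1 / 22" "2 \<le> t" for h t
    using B.gap_ge_exp[OF that] that EX1[of t] by (simp add: B.gap_def Y_def)
  let ?weak = "\<lambda>h t. norm (integral\<^sup>L M (X t) - integral\<^sup>L M (Y h t))"
  let ?strong = "\<lambda>h t. expectation (\<lambda>\<omega>. norm (X t \<omega> - Y h t \<omega>))"
  have weak_le_strong: "?weak h t \<le> ?strong h t" if "0 < h" "0 \<le> t" for h t
    using integral_norm_bound[of M "\<lambda>\<omega>. X t \<omega> - Y h t \<omega>"] X_integrable Y_int that by simp
  have weak_lower: "exp (- 14 * \<bar>ln h\<bar> powr (2 / 3)) \<le> ?weak h t" if "0 < h" "h \<le> 1 / 22" "2 \<le> t" for h t
  proof -
    have "\<bar>(integral\<^sup>L M (X t) - integral\<^sup>L M (Y h t)) $ 1\<bar> \<le> ?weak h t"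
      by (rule component_le_norm_cart)
    then show ?thesis
      using lower[OF that] X_integrable[of t] Y_int[of h t] that by (simp add: integral_vec_nth)
  qed
  \<comment> \<open>Coordinates 2 and 4 agree exactly and the third differs by at most
    \<open>h\<close>, so only the first needs a limit argument.\<close>
  have strong_upper: "?strong h t \<le> expectation (\<lambda>\<omega>. \<bar>int_on t - Y h t \<omega> $ 1\<bar>) + h" if "0 < h" "0 \<le> t" for h t
  proof -
    interpret E: euler_scheme W h by standard fact
    have i: "integrable M (\<lambda>\<omega>. \<bar>int_on t - Y h t \<omega> $ 1\<bar>)"
      unfolding Y_def using B.Y_nth_integrable[OF that, of 1] by simp
    have "?strong h t \<le> expectation (\<lambda>\<omega>. \<bar>int_on t - Y h t \<omega> $ 1\<bar> + h)"
    proof (rule integral_mono_AE)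
      show "AE \<omega> in M. norm (X t \<omega> - Y h t \<omega>) \<le> \<bar>int_on t - Y h t \<omega> $ 1\<bar> + h"
        using X[OF \<open>0 \<le> t\<close>]
      proof eventually_elim
        case (elim \<omega>)
        have "norm (X t \<omega> - Y h t \<omega>) \<le> (\<Sum>i\<in>UNIV. \<bar>(X t \<omega> - Y h t \<omega>) $ i\<bar>)"
          by (rule norm_le_l1_cart)
        also have "\<dots> = \<bar>int_on t - Y h t \<omega> $ 1\<bar> + \<bar>E.Y3 t - int_off t\<bar>"
          using \<open>0 \<le> t\<close> by (simp add: sum_4 elim vector_4_nth Y_def E.Y2 E.Y3 E.Y4 abs_minus_commute)
        finally show ?case using E.Y3_error[OF \<open>0 \<le> t\<close>] by linarith
      qed
    qed (use i X_integrable Y_int that in auto)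
    also have "\<dots> = expectation (\<lambda>\<omega>. \<bar>int_on t - Y h t \<omega> $ 1\<bar>) + h"
      using i by (simp add: prob_space)
    finally show ?thesis .
  qed
  have small: "\<forall>\<^sub>F h :: real in at_right 0. 0 < h \<and> h \<le> 1 / 22"
    unfolding eventually_at_right_field by (rule exI[of _ "1/22"]) auto
  have strong_0: "((\<lambda>h. ?strong h t) \<longlongrightarrow> 0) (at_right 0)" if "2 \<le> t" for t
  proof (rule tendsto_sandwich[OF _ _ tendsto_const])
    have "((\<lambda>h. expectation (\<lambda>\<omega>. \<bar>int_on t - Y h t \<omega> $ 1\<bar>) + h) \<longlongrightarrow> 0 + 0) (at_right 0)"
      unfolding Y_def using that by (intro tendsto_add B.Y1_L1_convergence assms(3) tendsto_ident_at) simp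
    then show "((\<lambda>h. expectation (\<lambda>\<omega>. \<bar>int_on t - Y h t \<omega> $ 1\<bar>) + h) \<longlongrightarrow> 0) (at_right 0)" by simp
    show "\<forall>\<^sub>F h in at_right 0. ?strong h t \<le> expectation (\<lambda>\<omega>. \<bar>int_on t - Y h t \<omega> $ 1\<bar>) + h"
      using small by eventually_elim (use strong_upper that in auto)
  qed auto
  have weak_0: "((\<lambda>h. ?weak h t) \<longlongrightarrow> 0) (at_right 0)" if "2 \<le> t" for t
  proof (rule tendsto_sandwich[OF _ _ tendsto_const strong_0[OF that]])
    show "\<forall>\<^sub>F h in at_right 0. ?weak h t \<le> ?strong h t"
      using small by eventually_elim (use weak_le_strong that in auto)
  qed auto
  \<comment> \<open>Stated for an arbitrary error function \<open>e\<close>, so that the strong and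
    the weak error are handled together.\<close>
  have diverges: "filterlim (\<lambda>h. e h / h powr \<alpha>) at_top (at_right 0)"
    if "0 < \<alpha>" "\<And>h. 0 < h \<Longrightarrow> h \<le> 1 / 22 \<Longrightarrow> exp (- 14 * \<bar>ln h\<bar> powr (2 / 3)) \<le> e h" for e and \<alpha> :: real
    by (rule filterlim_at_top_mono[OF lower_rate_divergence[OF that(1)]])
      (use small in eventually_elim, rule divide_right_mono[OF that(2)], auto)
  have limit: "((\<lambda>h. ereal (e h / h powr \<alpha>)) \<longlongrightarrow> (if \<alpha> = 0 then 0 else \<infinity>)) (at_right 0)"
    if "0 \<le> \<alpha>" "(e \<longlongrightarrow> 0) (at_right 0)"
      "\<And>h. 0 < h \<Longrightarrow> h \<le> 1 / 22 \<Longrightarrow> exp (- 14 * \<bar>ln h\<bar> powr (2 / 3)) \<le> e h" for e and \<alpha> :: real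
  proof (cases "\<alpha> = 0")
    case True
    \<comment> \<open>\<open>h powr 0\<close> is 1 for positive \<open>h\<close>, but
      \<open>0 powr 0\<close> is 0; the two functions are compared only eventually to the right of
      0.\<close>
    have "((\<lambda>h. e h / h powr 0) \<longlongrightarrow> 0) (at_right 0)"
      by (rule Lim_transform_eventually[OF that(2)]) (use small in eventually_elim, auto)
    then show ?thesis using True by (auto simp: zero_ereal_def)
  next
    case False
    then show ?thesis using diverges[OF _ that(3)] that(1) by (simp add: tendsto_PInfty_eq_at_top)
  qed
  have strong_lower: "exp (- 14 * \<bar>ln h\<bar> powr (2 / 3)) \<le> ?strong h t" if "0 < h" "h \<le> 1 / 22" "2 \<le> t" for h t
    using weak_lower[OF that] weak_le_strong[of h t] that by linarith
  have witness: "\<exists>h\<in>{0<..<h\<^sub>0}. ?weak h t > C * h powr \<alpha>" if "2 \<le> t" "0 < \<alpha>" "0 < h\<^sub>0" for t \<alpha> C h\<^sub>0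
  proof -
    have "\<forall>\<^sub>F h in at_right 0. C < ?weak h t / h powr \<alpha>"
      using diverges[OF \<open>0 < \<alpha>\<close> weak_lower] that by (simp add: filterlim_at_top_dense)
    moreover have "\<forall>\<^sub>F h in at_right 0. h \<in> {0<..<h\<^sub>0}"
      using \<open>0 < h\<^sub>0\<close> by (rule eventually_at_right_real)
    ultimately have "\<forall>\<^sub>F h in at_right 0. h \<in> {0<..<h\<^sub>0} \<and> C < ?weak h t / h powr \<alpha>"
      by eventually_elim auto
    then obtain h where "h \<in> {0<..<h\<^sub>0}" "C < ?weak h t / h powr \<alpha>"
      using eventually_happens' trivial_limit_at_right_real by blast
    then show ?thesis by (intro bexI[of _ h]) (auto simp: pos_less_divide_eq)
  qed
  show ?thesis
    by (intro conjI allI impI X_integrable Y_int lower limit strong_0 strong_lower weak_0 weak_lower witness) auto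
qed

end
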